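(* Let $h\in\mathbb{N}^*$, let $\tilde\eta\in\mathbb{K}[[t_1,t_2,\dots,t_h]]^*$ and $\tilde\xi\in\mathbb{K}[[u_1,t_2,\dots,t_h]]^*$ be dual to each other relative to the first variable, and let $m_1,n_1\in\mathbb{N}^*$. Let $\tilde a$ be the constant term of $\tilde\eta$, and let $(\nu_1,\dots,\nu_h)$ be the canonical basis of $\mathbb{Z}^h$. Put $$\eta(t_1,t_2,\dots,t_h)=(t_1\,\tilde\eta(t_1,t_2,\dots,t_h))^{m_1},\qquad \xi(u_1,t_2,\dots,t_h)=(u_1\,\tilde\xi(u_1,t_2,\dots,t_h))^{n_1}.$$ Let $\preceq$ be an additive order on $\mathbb{Q}^h$ dominating $\mathbb{Q}^h_+$, and denote the sequences of essential exponents by $$\mathrm{ess}(\eta,\ n_1\mathbb{Z}\nu_1+\mathbb{Z}\nu_2+\cdots+\mathbb{Z}\nu_h,\ \preceq)=(m_1\nu_1,\epsilon_1,\dots,\epsilon_d),$$ $$\mathrm{ess}(\xi,\ m_1\mathbb{Z}\nu_1+\mathbb{Z}\nu_2+\cdots+\mathbb{Z}\nu_h,\ \preceq)=(n_1\nu_1,\epsilon'_1,\dots,\epsilon'_{d'}).$$ Write $\epsilon_{k,1}$ for the first coordinate of $\epsilon_k$ (the coefficient of $\nu_1$ in $\epsilon_k=\sum_{i=1}^h\epsilon_{k,i}\nu_i$). Then: (1) $d'=d$; (2) $\epsilon'_k+m_1\nu_1=\epsilon_k+n_1\nu_1$ for all $k\in\{1,\dots,d\}$; (3) $[\xi]_{n_1\nu_1}=\tilde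 a^{-n_1}$ and $$[\xi]_{\epsilon'_k}=-\frac{n_1}{m_1}\,\tilde a^{-n_1-\epsilon_{k,1}}\,[\eta]_{\epsilon_k}\quad\text{for all }k\in\{1,\dots,d\}.$$
   Context: $\mathbb{K}$ is an algebraically closed field of characteristic zero; $\mathbb{N}$ is the set of non-negative integers and $\mathbb{N}^*=\mathbb{N}\setminus\{0\}$. $\mathbb{K}[[t_1,\dots,t_h]]^*$ is the set of formal power series with non-zero constant term. For a series $\phi$ and an exponent vector $r$, $[\phi]_r\in\mathbb{K}$ is the coefficient of the monomial with exponent $r$, and the support $\mathcal{S}(\phi)$ is the set of exponents with non-zero coefficient. Dual relative to the first variable: if $\phi\in\mathbb{K}[[t_1,\dots,t_h]]^*$, its dual relative to the first variable is the unique series $\check{\phi}\in\mathbb{K}[[u_1,t_2,\dots,t_h]]^*$ such that the maps $(u_1,t_2,\dots,t_h)\mapsto(u_1\check{\phi}(u_1,t_2,\dots,t_h),t_2,\dots,t_h)$ and $(t_1,t_2,\dots,t_h)\mapsto(t_1\phi(t_1,\dots,t_h),t_2,\dots,t_h)$ are reciprocal (inverse for composition). A set with bounded denominators in $\mathbb{Q}^h_+$ is a non-empty set $E$ contained in $\frac1n\mathbb{N}^h$ for some $n\in\mathbb{N}^*$. A lattice of $\mathbb{Q}^h$ is a free subgroup of rank $h$. An additive order on $\mathbb{Q}^h$ is a total order $\preceq$ such that $\alpha\preceq\beta$ implies $\alpha+\gamma\preceq\beta+\gamma$ for all $\alpha,\beta,\gamma\in\mathbb{Q}^h$. It dominates $\theta\subset\mathbb{Q}^h$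 if every non-empty subset of $\theta$ with bounded denominators has a minimum for $\preceq$. Essential elements: for $E\subset\mathbb{Q}^h_+$ with bounded denominators, a lattice $M$ of $\mathbb{Q}^h$, and an additive order $\preceq$ dominating $\mathbb{Q}^h_+$, the sequence $\mathrm{ess}(E,M,\preceq)=(e_0,e_1,\dots)$ is defined inductively (all minima taken for $\preceq$): $e_0=\min E$; for $l\ge1$, $e_l$ is defined if and only if $E\not\subset M+\mathbb{Z}\{e_0,\dots,e_{l-1}\}$, and then $e_l=\min\bigl(E\setminus(M+\mathbb{Z}\{e_0,\dots,e_{l-1}\})\bigr)$. Here $\mathbb{Z}\{\dots\}$ is the subgroup generated. For a non-zero series $\phi$, $\mathrm{ess}(\phi,M,\preceq):=\mathrm{ess}(\mathcal{S}(\phi),M,\preceq)$. *)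

theory Defs
  imports
    "HOL-Analysis.Finite_Cartesian_Product"
    "HOL-Library.Set_Algebras"
    "HOL-Computational_Algebra.Polynomial"
    "HOL-Computational_Algebra.Group_Closure"
begin

section \<open>Formal power series in finitely many variables\<close>

text \<open>
  The variables are indexed by a finite type \<open>'h\<close>, so that \<open>h = CARD('h)\<close> and exponent vectors
  have type \<open>nat ^ 'h\<close>. The ``first'' variable is a chosen index \<open>i :: 'h\<close>.
\<close>

typedef ('k, 'h) mfps = "UNIV :: (nat ^ 'h \<Rightarrow> 'k) set"
  morphisms mfps_nth Abs_mfps ..

lemma Abs_mfps_inverse' [simp]: "mfps_nth (Abs_mfps f) = f"
  by (simp add: Abs_mfps_inverse)

lemma mfps_eqI: "(\<And>r. mfps_nth f r = mfps_nth g r) \<Longrightarrow> f = g"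
  by (metis ext mfps_nth_inject)

lemma finite_vec_le: "finite {p :: nat ^ 'h. \<forall>j. p $ j \<le> r $ j}"
proof -
  have "finite (PiE UNIV (\<lambda>j. {..r $ j}))"
    by (rule finite_PiE) auto
  moreover have "{p :: nat ^ 'h. \<forall>j. p $ j \<le> r $ j} \<subseteq> vec_lambda ` PiE UNIV (\<lambda>j. {..r $ j})"
  proof
    fix p :: "nat ^ 'h" assume "p \<in> {p. \<forall>j. p $ j \<le> r $ j}"
    then have "vec_nth p \<in> PiE UNIV (\<lambda>j. {..r $ j})" by auto
    then show "p \<in> vec_lambda ` PiE UNIV (\<lambda>j. {..r $ j})"
      by (metis image_eqI vec_nth_inverse)
  qed
  ultimately show ?thesis by (meson finite_imageI finite_subset)
qed

lemma finite_vec_add_eq [simp]: "finite {(p, q). p + q = (r :: nat ^ 'h)}"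
proof (rule finite_subset)
  show "{(p, q). p + q = r} \<subseteq>
      {p :: nat ^ 'h. \<forall>j. p $ j \<le> r $ j} \<times> {p :: nat ^ 'h. \<forall>j. p $ j \<le> r $ j}"
    by auto
qed (use finite_vec_le in blast)

instantiation mfps :: (comm_ring_1, finite) comm_ring_1
begin

definition zero_mfps :: "('a, 'b) mfps"
  where "0 = Abs_mfps (\<lambda>r. 0)"

definition one_mfps :: "('a, 'b) mfps"
  where "1 = Abs_mfps (\<lambda>r. if r = 0 then 1 else 0)"

definition plus_mfps :: "('a, 'b) mfps \<Rightarrow> ('a, 'b) mfps \<Rightarrow> ('a, 'b) mfps"
  where "f + g = Abs_mfps (\<lambda>r. mfps_nth f r + mfps_nth g r)"

definition uminus_mfps :: "('a, 'b) mfps \<Rightarrow> ('a, 'b) mfps"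
  where "- f = Abs_mfps (\<lambda>r. - mfps_nth f r)"

definition minus_mfps :: "('a, 'b) mfps \<Rightarrow> ('a, 'b) mfps \<Rightarrow> ('a, 'b) mfps"
  where "f - g = Abs_mfps (\<lambda>r. mfps_nth f r - mfps_nth g r)"

definition times_mfps :: "('a, 'b) mfps \<Rightarrow> ('a, 'b) mfps \<Rightarrow> ('a, 'b) mfps"
  where "f * g = Abs_mfps (\<lambda>r. \<Sum>(p, q) \<in> {(p, q). p + q = r}. mfps_nth f p * mfps_nth g q)"

instance
proof
  fix a b c :: "('a, 'b) mfps"
  show "a * b * c = a * (b * c)"
  proof (rule mfps_eqI)
    fix r :: "nat ^ 'b"
    let ?P = "\<lambda>r. {(p, q). p + q = (r :: nat ^ 'b)}"
    let ?a = "mfps_nth a" and ?b = "mfps_nth b" and ?c = "mfps_nth c"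
    have "mfps_nth (a * b * c) r =
        (\<Sum>x\<in>?P r. \<Sum>y\<in>?P (fst x). ?a (fst y) * ?b (snd y) * ?c (snd x))"
      by (simp add: times_mfps_def case_prod_unfold sum_distrib_right)
    also have "\<dots> = (\<Sum>(x, y)\<in>Sigma (?P r) (\<lambda>x. ?P (fst x)). ?a (fst y) * ?b (snd y) * ?c (snd x))"
      by (rule sum.Sigma) auto
    also have "\<dots> = (\<Sum>(x, y)\<in>Sigma (?P r) (\<lambda>x. ?P (snd x)). ?a (fst x) * (?b (fst y) * ?c (snd y)))"
      by (rule sum.reindex_bij_witness
          [where i = "\<lambda>((p, q), (s, t)). ((p + s, t), (p, s))"
             and j = "\<lambda>((p, q), (s, t)). ((s, t + q), (t, q))"])
         (auto simp: add.assoc mult.assoc)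
    also have "\<dots> = (\<Sum>x\<in>?P r. \<Sum>y\<in>?P (snd x). ?a (fst x) * (?b (fst y) * ?c (snd y)))"
      by (rule sum.Sigma [symmetric]) auto
    also have "\<dots> = mfps_nth (a * (b * c)) r"
      by (simp add: times_mfps_def case_prod_unfold sum_distrib_left)
    finally show "mfps_nth (a * b * c) r = mfps_nth (a * (b * c)) r" .
  qed
  show "a * b = b * a"
  proof (rule mfps_eqI)
    fix r
    show "mfps_nth (a * b) r = mfps_nth (b * a) r"
      unfolding times_mfps_def Abs_mfps_inverse'
      by (rule sum.reindex_bij_witness [where i = prod.swap and j = prod.swap])
         (auto simp: add.commute mult.commute)
  qed
  show "1 * a = a"
  proof (rule mfps_eqI)
    fix r
    have "mfps_nth (1 * a) r =
        (\<Sum>x\<in>{(p, q). p + q = r}. if x = (0, r) then mfps_nth a r else 0)"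
      unfolding times_mfps_def one_mfps_def Abs_mfps_inverse'
      by (rule sum.cong) (auto split: if_splits)
    then show "mfps_nth (1 * a) r = mfps_nth a r"
      by (simp add: sum.delta)
  qed
  show "(a + b) * c = a * c + b * c"
    by (rule mfps_eqI)
       (simp add: times_mfps_def plus_mfps_def case_prod_unfold distrib_right sum.distrib)
  show "(0 :: ('a, 'b) mfps) \<noteq> 1"
  proof
    assume "(0 :: ('a, 'b) mfps) = 1"
    then have "mfps_nth (0 :: ('a, 'b) mfps) 0 = mfps_nth 1 0" by simp
    then show False by (simp add: zero_mfps_def one_mfps_def)
  qed
qed (rule mfps_eqI; simp add: plus_mfps_def zero_mfps_def uminus_mfps_def minus_mfps_def
       add.assoc add.commute)+

end

definition mfps_X :: "'h \<Rightarrow> ('k :: comm_ring_1, 'h :: finite) mfps"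
  where "mfps_X j = Abs_mfps (\<lambda>r. if r = axis j 1 then 1 else 0)"

text \<open>
  Substitution of the family \<open>G\<close> into \<open>F\<close>; meaningful only if every \<open>G j\<close> has zero constant term.
  Then the coefficient of the monomial with exponent \<open>r\<close> in \<open>\<Prod>j. G j ^ (a $ j)\<close> vanishes as soon as
  the total degree of \<open>a\<close> exceeds that of \<open>r\<close>, which is why the sum below can be truncated.
\<close>
definition mfps_compose ::
    "('k :: comm_ring_1, 'h :: finite) mfps \<Rightarrow> ('h \<Rightarrow> ('k, 'h) mfps) \<Rightarrow> ('k, 'h) mfps"
  where "mfps_compose F G = Abs_mfps (\<lambda>r.
    \<Sum>a | (\<Sum>j\<in>UNIV. a $ j) \<le> (\<Sum>j\<in>UNIV. r $ j).
      mfps_nth F a * mfps_nth (\<Prod>j\<in>UNIV. G j ^ (a $ j)) r)"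

text \<open>The map multiplying the coordinate \<open>i\<close> by \<open>\<phi>\<close> and fixing the others, as a family of series.\<close>
definition mult_map ::
    "'h \<Rightarrow> ('k :: comm_ring_1, 'h :: finite) mfps \<Rightarrow> 'h \<Rightarrow> ('k, 'h) mfps"
  where "mult_map i \<phi> = (\<lambda>j. if j = i then mfps_X i * \<phi> else mfps_X j)"

text \<open>
  \<open>\<psi>\<close> is the dual of \<open>\<phi>\<close> relative to the variable \<open>i\<close>. This is stated as a (symmetric) relation, so
  existence and uniqueness of the dual are not presupposed.
\<close>
definition dual_wrt ::
    "'h \<Rightarrow> ('k :: comm_ring_1, 'h :: finite) mfps \<Rightarrow> ('k, 'h) mfps \<Rightarrow> bool"
  where "dual_wrt i \<phi> \<psi> \<longleftrightarrow> mfps_nth \<phi> 0 \<noteq> 0 \<and> mfps_nth \<psi> 0 \<noteq> 0 \<and>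
    (\<forall>j. mfps_compose (mult_map i \<phi> j) (mult_map i \<psi>) = mfps_X j) \<and>
    (\<forall>j. mfps_compose (mult_map i \<psi> j) (mult_map i \<phi>) = mfps_X j)"

definition rat_vec :: "nat ^ 'h \<Rightarrow> rat ^ 'h"
  where "rat_vec a = (\<chi> j. of_nat (a $ j))"

definition mfps_support :: "('k :: zero, 'h) mfps \<Rightarrow> (rat ^ 'h) set"
  where "mfps_support \<phi> = rat_vec ` {a. mfps_nth \<phi> a \<noteq> 0}"


section \<open>Additive orders and essential elements\<close>

text \<open>Orders are relations, \<open>(\<alpha>, \<beta>) \<in> R\<close> meaning \<open>\<alpha> \<preceq> \<beta>\<close>.\<close>

definition bounded_denominators :: "(rat ^ 'h) set \<Rightarrow> bool"
  where "bounded_denominators E \<longleftrightarrow> E \<noteq> {} \<and>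
    (\<exists>n :: nat. n > 0 \<and> (\<forall>x\<in>E. \<exists>a :: nat ^ 'h. \<forall>j. x $ j = of_nat (a $ j) / of_nat n))"

definition additive_order :: "(rat ^ 'h) rel \<Rightarrow> bool"
  where "additive_order R \<longleftrightarrow> linear_order R \<and>
    (\<forall>\<alpha> \<beta> \<gamma>. (\<alpha>, \<beta>) \<in> R \<longrightarrow> (\<alpha> + \<gamma>, \<beta> + \<gamma>) \<in> R)"

definition is_minimum :: "'a rel \<Rightarrow> 'a set \<Rightarrow> 'a \<Rightarrow> bool"
  where "is_minimum R A m \<longleftrightarrow> m \<in> A \<and> (\<forall>x\<in>A. (m, x) \<in> R)"

definition minimum :: "'a rel \<Rightarrow> 'a set \<Rightarrow> 'a"
  where "minimum R A = (THE m. is_minimum R A m)"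

definition dominates :: "(rat ^ 'h) rel \<Rightarrow> (rat ^ 'h) set \<Rightarrow> bool"
  where "dominates R T \<longleftrightarrow>
    (\<forall>A. A \<subseteq> T \<and> bounded_denominators A \<longrightarrow> (\<exists>m. is_minimum R A m))"

text \<open>
  The possibly finite sequence of essential elements: \<open>ess E M R l\<close> is \<open>None\<close> iff \<open>e\<^sub>l\<close> is undefined.
  The first summand \<open>M\<close> is a subgroup, and \<open>+\<close> is the sum of sets. If some earlier \<open>e\<^sub>j\<close> is undefined,
  then \<open>E\<close> is contained in the group below, so \<open>e\<^sub>l\<close> is undefined as well.
\<close>
fun ess :: "(rat ^ 'h) set \<Rightarrow> (rat ^ 'h) set \<Rightarrow> (rat ^ 'h) rel \<Rightarrow> nat \<Rightarrow> (rat ^ 'h) option"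
  where "ess E M R l =
    (if l = 0 then Some (minimum R E)
     else let H = M + group_closure {e. \<exists>j\<in>{..<l}. ess E M R j = Some e}
          in if E \<subseteq> H then None else Some (minimum R (E - H)))"

declare ess.simps [simp del]

text \<open>The lattice generated by \<open>n\<close> times the basis vector of index \<open>i\<close> and the other basis vectors.\<close>
definition coord_lattice :: "'h \<Rightarrow> nat \<Rightarrow> (rat ^ 'h) set"
  where "coord_lattice i n = group_closure (range (\<lambda>j. axis j (if j = i then of_nat n else 1)))"

end

theory Submission
  imports Defs
begin

text \<open>
  Fix a subgroup \<open>K\<close> of \<open>\<rat>\<^sup>h\<close> and an exponent \<open>e \<notin>
  K\<close>. The series whose exponents all lie in \<open>K\<close> or are \<open>\<succeq> e\<close> form a
  ring, on which the coefficient at \<open>e\<close> is a derivation over the constant term. Hence a series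
  \<open>\<phi>\<close> with nonzero constant term and its powers have the same first exponent outside
  \<open>K\<close>. Extracting the coefficient at \<open>e + \<nu>\<^sub>1\<close> of the composition that
  defines the dual gives \<open>\<phi>\<^sub>0 \<psi>\<^sub>e + \<phi>\<^sub>e \<psi>\<^sub>0^(e\<^sub>1 + 1)
  = 0\<close>, so dual series \<open>\<phi>\<close>, \<open>\<psi>\<close> also share their first exponent
  outside \<open>K\<close>. The groups in the two recursions agree from \<open>n\<int>\<nu>\<^sub>1 +
  m\<int>\<nu>\<^sub>1 + \<int>\<nu>\<^sub>2 + \<dots> + \<int>\<nu>\<^sub>h\<close> on, because paired
  essential exponents differ by \<open>(m - n)\<nu>\<^sub>1\<close>.
\<close>

section \<open>Monomials and coefficients of compositions\<close>

lemma mfps_nth_mult: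
  "mfps_nth (f * g) r = (\<Sum>(p, q) \<in> {(p, q). p + q = r}. mfps_nth f p * mfps_nth g q)"
  by (simp add: times_mfps_def)

lemma mfps_nth_one: "mfps_nth 1 r = (if r = 0 then 1 else 0)"
  by (simp add: one_mfps_def)

lemma vec_nat_add_eq_0_iff: "p + q = 0 \<longleftrightarrow> p = 0 \<and> q = 0" for p q :: "nat ^ 'h"
  by (auto simp: vec_eq_iff)

lemma mfps_nth_mult_0: "mfps_nth (f * g) 0 = mfps_nth f 0 * mfps_nth g 0"
proof -
  have "{(p, q). p + q = (0 :: nat ^ 'b)} = {(0, 0)}"
    by (auto simp: vec_nat_add_eq_0_iff)
  then show ?thesis by (simp add: mfps_nth_mult)
qed

lemma mfps_nth_power_0: "mfps_nth (f ^ k) 0 = mfps_nth f 0 ^ k"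
  by (induction k) (simp_all add: mfps_nth_one mfps_nth_mult_0)

definition mfps_monom :: "nat ^ 'h \<Rightarrow> ('k :: comm_ring_1, 'h :: finite) mfps"
  where "mfps_monom a = Abs_mfps (\<lambda>r. if r = a then 1 else 0)"

lemma mfps_nth_monom_mult:
  "mfps_nth (mfps_monom a * f) (a + r) = mfps_nth f r"
proof -
  have "mfps_nth (mfps_monom a * f) (a + r) =
      (\<Sum>x\<in>{(p, q). p + q = a + r}. if x = (a, r) then mfps_nth f r else 0)"
    unfolding mfps_nth_mult mfps_monom_def Abs_mfps_inverse'
    by (rule sum.cong) (auto split: if_splits)
  then show ?thesis by (simp add: sum.delta)
qed

lemma mfps_nth_monom_mult_eq_0:
  "(\<And>s. r \<noteq> a + s) \<Longrightarrow> mfps_nth (mfps_monom a * f) r = 0"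
  unfolding mfps_nth_mult mfps_monom_def Abs_mfps_inverse'
  by (rule sum.neutral) auto

lemma mfps_monom_mult:
  "mfps_monom a * mfps_monom b = (mfps_monom (a + b) :: ('k :: comm_ring_1, 'h :: finite) mfps)"
proof (rule mfps_eqI)
  fix r
  show "mfps_nth (mfps_monom a * mfps_monom b :: ('k, 'h) mfps) r = mfps_nth (mfps_monom (a + b)) r"
  proof (cases "\<exists>s. r = a + s")
    case True
    then show ?thesis by (auto simp: mfps_nth_monom_mult) (auto simp: mfps_monom_def)
  next
    case False
    then show ?thesis by (subst mfps_nth_monom_mult_eq_0) (auto simp: mfps_monom_def)
  qed
qed

lemma mfps_X_eq_monom: "mfps_X j = mfps_monom (axis j 1)"
  by (simp add: mfps_X_def mfps_monom_def)

lemma mfps_X_power: "mfps_X j ^ k = mfps_monom (axis j k)"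
proof (induction k)
  case 0
  show ?case by (rule mfps_eqI) (auto simp: mfps_nth_one mfps_monom_def)
next
  case (Suc k)
  have "axis j 1 + axis j k = axis j (Suc k)" by (simp add: axis_def vec_eq_iff)
  then show ?case unfolding power_Suc Suc by (simp add: mfps_X_eq_monom mfps_monom_mult)
qed

lemma prod_mfps_X_power:
  "(\<Prod>j\<in>UNIV. mfps_X j ^ (a $ j)) = (mfps_monom a :: ('k :: comm_ring_1, 'h :: finite) mfps)"
proof -
  have "(\<Prod>j\<in>J. mfps_X j ^ (a $ j)) = (mfps_monom (\<Sum>j\<in>J. axis j (a $ j)) :: ('k, 'h) mfps)"
    if "finite J" for J
    using that
  proof induction
    case empty
    show ?case by (simp add: mfps_monom_def one_mfps_def)
  qed (simp add: mfps_X_power mfps_monom_mult)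
  moreover have "(\<Sum>j\<in>UNIV. axis j (a $ j)) = a"
    by (simp add: vec_eq_iff axis_def)
  ultimately show ?thesis by simp
qed

section \<open>Substitution of a map that rescales one variable\<close>

lemma prod_mult_map_power:
  "(\<Prod>j\<in>UNIV. mult_map i \<psi> j ^ (a $ j)) = mfps_monom a * \<psi> ^ (a $ i)"
proof -
  have "(\<Prod>j\<in>UNIV. mult_map i \<psi> j ^ (a $ j)) =
      (\<Prod>j\<in>UNIV. mfps_X j ^ (a $ j) * (if j = i then \<psi> ^ (a $ i) else 1))"
    by (rule prod.cong) (auto simp: mult_map_def power_mult_distrib)
  then show ?thesis by (simp add: prod.distrib prod_mfps_X_power)
qed

text \<open>Since \<open>(mfps_X i * f) ^ k\<close> is the monomial \<open>axis i k\<close> times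
  \<open>f ^ k\<close>, questions about \<open>\<eta>\<close> and \<open>\<xi>\<close> become
  questions about powers of series with nonzero constant term.\<close>

lemma mfps_nth_X_mult_power:
  "mfps_nth ((mfps_X i * f) ^ k) r \<noteq> 0 \<longleftrightarrow> (\<exists>s. r = axis i k + s \<and> mfps_nth (f ^ k) s \<noteq> 0)"
  "mfps_nth ((mfps_X i * f) ^ k) (axis i k + s) = mfps_nth (f ^ k) s"
  unfolding power_mult_distrib mfps_X_power
  using mfps_nth_monom_mult [of "axis i k" "f ^ k"] mfps_nth_monom_mult_eq_0 [of r "axis i k" "f ^ k"]
  by auto metis

lemma mfps_nth_X_mult:
  "mfps_nth (mfps_X i * f) (axis i 1 + p) = mfps_nth f p"
  "(\<And>s. r \<noteq> axis i 1 + s) \<Longrightarrow> mfps_nth (mfps_X i * f) r = 0"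
  using mfps_nth_monom_mult [of "axis i 1" f] mfps_nth_monom_mult_eq_0 [of r "axis i 1" f]
  unfolding mfps_X_eq_monom by auto

text \<open>A monomial \<open>a\<close> of \<open>mfps_X i * \<phi>\<close> has the form
  \<open>axis i 1 + p\<close>, and substitution multiplies it by \<open>\<psi> ^ (a $ i)\<close>;
  the extra factor in the variable \<open>i\<close> accounts for the \<open>Suc\<close>.\<close>

lemma mfps_nth_compose_mult_map:
  fixes \<phi> \<psi> :: "('k :: comm_ring_1, 'h :: finite) mfps"
  shows "mfps_nth (mfps_compose (mult_map i \<phi> i) (mult_map i \<psi>)) (axis i 1 + e) =
    (\<Sum>(p, q)\<in>{(p, q). p + q = e}. mfps_nth \<phi> p * mfps_nth (\<psi> ^ Suc (p $ i)) q)"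
proof -
  let ?t = "\<lambda>a. mfps_nth (mfps_X i * \<phi>) a * mfps_nth (mfps_monom a * \<psi> ^ (a $ i)) (axis i 1 + e)"
  let ?A = "{a :: nat ^ 'h. (\<Sum>j\<in>UNIV. a $ j) \<le> (\<Sum>j\<in>UNIV. (axis i 1 + e) $ j)}"
  let ?B = "(\<lambda>(p, q). axis i 1 + p) ` {(p, q). p + q = e}"
  have inj: "inj_on (\<lambda>(p, q). axis i 1 + p) {(p, q). p + q = e}"
    by (auto simp: inj_on_def)
  have fin: "finite ?A"
  proof (rule finite_subset)
    show "?A \<subseteq> {p. \<forall>j. p $ j \<le> (\<chi> j. (\<Sum>j\<in>UNIV. (axis i 1 + e) $ j)) $ j}"
    proof
      fix a :: "nat ^ 'h" assume "a \<in> ?A"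
      moreover have "a $ j \<le> (\<Sum>j\<in>UNIV. a $ j)" for j by (rule member_le_sum) auto
      ultimately show "a \<in> {p. \<forall>j. p $ j \<le> (\<chi> j. (\<Sum>j\<in>UNIV. (axis i 1 + e) $ j)) $ j}"
        by (auto intro: order_trans)
    qed
  qed (rule finite_vec_le)
  have "mfps_nth (mfps_compose (mult_map i \<phi> i) (mult_map i \<psi>)) (axis i 1 + e) = sum ?t ?A"
    by (simp add: mfps_compose_def prod_mult_map_power) (simp add: mult_map_def)
  \<comment> \<open>A nonzero term needs \<open>axis i 1\<close> to divide the monomial
    \<open>a\<close>, and \<open>a\<close> to divide \<open>axis i 1 + e\<close>. All such
    \<open>a\<close> satisfy the degree bound, so the truncation in \<open>mfps_compose\<close>
    loses nothing.\<close>
  also have "\<dots> = sum ?t ?B"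
  proof (rule sum.mono_neutral_right [OF fin])
    show "?B \<subseteq> ?A" by (auto intro!: sum_mono)
    show "\<forall>a\<in>?A - ?B. ?t a = 0"
    proof
      fix a assume a: "a \<in> ?A - ?B"
      show "?t a = 0"
      proof (rule ccontr)
        assume "?t a \<noteq> 0"
        then obtain p q where "a = axis i 1 + p" "axis i 1 + e = a + q"
          using mfps_nth_X_mult(2) [of a i \<phi>]
            mfps_nth_monom_mult_eq_0 [of "axis i 1 + e" a "\<psi> ^ (a $ i)"]
          by (metis mult_zero_left mult_zero_right)
        then have "a = axis i 1 + p" "p + q = e" by (simp_all add: add.assoc)
        with a show False by auto
      qed
    qed
  qed
  also have "\<dots> = (\<Sum>(p, q)\<in>{(p, q). p + q = e}. ?t (axis i 1 + p))"
    by (subst sum.reindex [OF inj]) (simp add: case_prod_unfold comp_def)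
  also have "\<dots> = (\<Sum>(p, q)\<in>{(p, q). p + q = e}. mfps_nth \<phi> p * mfps_nth (\<psi> ^ Suc (p $ i)) q)"
  proof (rule sum.cong [OF refl])
    fix x assume "x \<in> {(p, q). p + q = e}"
    then obtain p q where "x = (p, q)" "e = p + q" by auto
    then show "(case x of (p, q) \<Rightarrow> ?t (axis i 1 + p)) =
        (case x of (p, q) \<Rightarrow> mfps_nth \<phi> p * mfps_nth (\<psi> ^ Suc (p $ i)) q)"
      using mfps_nth_monom_mult [of "axis i 1 + p" "\<psi> ^ Suc (p $ i)" q]
        mfps_nth_X_mult(1) [of i \<phi> p] by (simp add: add.assoc)
  qed
  finally show ?thesis .
qed

text \<open>Shared by the product rule and the dual identity: only the two trivial splittings
  survive, and \<open>e \<noteq> 0\<close> keeps them distinct.\<close>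

lemma sum_vec_add_eq_ends:
  fixes e :: "nat ^ 'h :: finite" and F :: "nat ^ 'h \<Rightarrow> nat ^ 'h \<Rightarrow> 'k :: comm_monoid_add"
  assumes "e \<noteq> 0" and zero: "\<And>p q. p + q = e \<Longrightarrow> p \<noteq> 0 \<Longrightarrow> q \<noteq> 0 \<Longrightarrow> F p q = 0"
  shows "(\<Sum>(p, q)\<in>{(p, q). p + q = e}. F p q) = F 0 e + F e 0"
proof -
  have "(\<Sum>(p, q)\<in>{(p, q). p + q = e}. F p q) = (\<Sum>(p, q)\<in>{(0, e), (e, 0)}. F p q)"
  proof (rule sum.mono_neutral_right)
    show "\<forall>x\<in>{(p, q). p + q = e} - {(0, e), (e, 0)}. (case x of (p, q) \<Rightarrow> F p q) = 0"
    proof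
      fix x assume "x \<in> {(p, q). p + q = e} - {(0, e), (e, 0)}"
      moreover obtain p q where "x = (p, q)" by fastforce
      ultimately have "p + q = e" "p \<noteq> 0" "q \<noteq> 0" "x = (p, q)" by auto
      then show "(case x of (p, q) \<Rightarrow> F p q) = 0" by (simp add: zero)
    qed
  qed auto
  with \<open>e \<noteq> 0\<close> show ?thesis by simp
qed

section \<open>Subgroups generated by exponents\<close>

lemma rat_vec_0 [simp]: "rat_vec 0 = 0"
  by (simp add: rat_vec_def vec_eq_iff)

lemma rat_vec_add: "rat_vec (p + q) = rat_vec p + rat_vec q"
  by (simp add: rat_vec_def vec_eq_iff)

lemma rat_vec_eq_iff [simp]: "rat_vec p = rat_vec q \<longleftrightarrow> p = q"
  by (simp add: rat_vec_def vec_eq_iff)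

lemma rat_vec_axis: "rat_vec (axis i k) = axis i (of_nat k)"
  by (simp add: rat_vec_def vec_eq_iff axis_def)

lemma group_closure_add_iff:
  "x \<in> group_closure B \<Longrightarrow> x + y \<in> group_closure B \<longleftrightarrow> y \<in> group_closure B"
  using group_closure.diff [of "x + y" B x] group_closure_add [of x B y] by auto

lemma group_closure_least:
  "B \<subseteq> group_closure C \<Longrightarrow> group_closure B \<subseteq> group_closure C"
proof
  fix x assume "B \<subseteq> group_closure C" "x \<in> group_closure B"
  from this(2,1) show "x \<in> group_closure C"
    by induction (auto intro: group_closure.diff)
qed

lemma group_closure_mono: "B \<subseteq> C \<Longrightarrow> group_closure B \<subseteq> group_closure C"
  by (rule group_closure_least) (auto intro: group_closure.base)

text \<open>Turns the sum of a lattice and a generated group in \<open>ess\<close> into one closure,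
  so that it suffices to compare generating sets.\<close>

lemma group_closure_plus: "group_closure B + group_closure C = group_closure (B \<union> C)"
proof
  have "group_closure B \<subseteq> group_closure (B \<union> C)" "group_closure C \<subseteq> group_closure (B \<union> C)"
    by (simp_all add: group_closure_mono)
  then show "group_closure B + group_closure C \<subseteq> group_closure (B \<union> C)"
    by (auto elim!: set_plus_elim intro: group_closure_add)
  show "group_closure (B \<union> C) \<subseteq> group_closure B + group_closure C"
  proof
    fix x assume "x \<in> group_closure (B \<union> C)"
    then show "x \<in> group_closure B + group_closure C"
    proof induction
      case (base s)
      then have "s \<in> group_closure B \<or> s \<in> group_closure C"
        by (auto intro: group_closure.base)
      then show ?case
        using set_plus_intro [of s "group_closure B" 0 "group_closure C"]
          set_plus_intro [of 0 "group_closure B" s "group_closure C"] by auto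
    next
      case (diff s t)
      then obtain b c b' c' where "s = b + c" "t = b' + c'"
        "b \<in> group_closure B" "b' \<in> group_closure B" "c \<in> group_closure C" "c' \<in> group_closure C"
        by (auto elim!: set_plus_elim)
      then have "s - t = (b - b') + (c - c')"
        "b - b' \<in> group_closure B" "c - c' \<in> group_closure C"
        by (auto intro: group_closure.diff)
      then show ?case by (auto intro: set_plus_intro)
    qed
  qed
qed

lemma group_closure_insert_subset:
  assumes "group_closure B = group_closure C" and "x - y \<in> group_closure C"
  shows "group_closure (insert x B) \<subseteq> group_closure (insert y C)"
proof (rule group_closure_least, rule insert_subsetI)
  have *: "group_closure C \<subseteq> group_closure (insert y C)"
    by (simp add: group_closure_mono subset_insertI)
  have "y + (x - y) \<in> group_closure (insert y C)"
    using * assms(2) by (intro group_closure_add) (auto intro: group_closure.base)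
  then show "x \<in> group_closure (insert y C)" by simp
  have "B \<subseteq> group_closure B" by (auto intro: group_closure.base)
  with * assms(1) show "B \<subseteq> group_closure (insert y C)" by blast
qed

lemma group_closure_insert_cong:
  assumes "group_closure B = group_closure C" and "x - y \<in> group_closure C"
  shows "group_closure (insert x B) = group_closure (insert y C)"
  using group_closure_insert_subset [of B C x y] group_closure_insert_subset [of C B y x] assms
    group_closure_minus_iff [of "x - y" C]
  by (simp add: equalityI)

lemma axis_int_mult_in_group_closure:
  "axis j x \<in> group_closure B \<Longrightarrow> axis j (of_int z * x :: 'a :: comm_ring_1) \<in> group_closure B"
proof -
  assume x: "axis j x \<in> group_closure B"
  have nat: "axis j (of_nat k * x) \<in> group_closure B" for k
  proof (induction k)
    case (Suc k)
    have "axis j (of_nat (Suc k) * x) = axis j x + axis j (of_nat k * x)"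
      by (simp add: vec_eq_iff axis_def algebra_simps)
    with Suc x show ?case by (metis group_closure_add)
  qed (simp add: axis_def flip: zero_vec_def)
  have "axis j (- y) = - axis j y" for y :: 'a by (simp add: vec_eq_iff axis_def)
  then show ?thesis
    using nat by (cases z) (simp_all del: of_nat_Suc)
qed

section \<open>Lattices generated by multiples of the basis vectors\<close>

definition coord_lattice_gens :: "'h \<Rightarrow> nat \<Rightarrow> (rat ^ 'h) set"
  where "coord_lattice_gens i n = range (\<lambda>j. axis j (if j = i then of_nat n else 1))"

lemma coord_lattice_eq: "coord_lattice i n = group_closure (coord_lattice_gens i n)"
  by (simp add: coord_lattice_def coord_lattice_gens_def)

text \<open>Isolates the one generator that depends on \<open>n\<close>; the same vector is the
  essential exponent of index 0 of the other series.\<close>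

lemma coord_lattice_gens_eq:
  "coord_lattice_gens i n = insert (rat_vec (axis i n)) ((\<lambda>j. axis j 1) ` (- {i}))"
proof -
  have "UNIV = insert i (- {i})" by auto
  then have "coord_lattice_gens i n =
      (\<lambda>j. axis j (if j = i then of_nat n else 1)) ` insert i (- {i})"
    unfolding coord_lattice_gens_def by metis
  then show ?thesis by (simp add: rat_vec_axis)
qed

text \<open>Only the coordinate \<open>i\<close> can obstruct membership, as the other basis vectors
  belong to the lattice. So the residue modulo \<open>n\<close> determines the class of a natural
  exponent, which will bound the number of essential exponents.\<close>

lemma rat_vec_diff_in_coord_lattice:
  fixes p q :: "nat ^ 'h :: finite"
  assumes "p $ i mod n = q $ i mod n"
  shows "rat_vec p - rat_vec q \<in> coord_lattice i n"
proof -
  have *: "axis j (of_nat (p $ j) - of_nat (q $ j)) \<in> coord_lattice i n" for j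
  proof (cases "j = i")
    case True
    obtain z where "int (p $ i) - int (q $ i) = z * int n"
      using assms by (metis mod_eq_dvd_iff of_nat_mod dvd_def mult.commute)
    then have "of_nat (p $ i) - of_nat (q $ i) = of_int z * (of_nat n :: rat)"
      by (metis of_int_diff of_int_mult of_int_of_nat_eq)
    moreover have "axis i (of_nat n) \<in> coord_lattice i n"
      unfolding coord_lattice_eq coord_lattice_gens_eq
      by (auto intro: group_closure.base simp: rat_vec_axis)
    ultimately show ?thesis
      using True axis_int_mult_in_group_closure unfolding coord_lattice_eq by metis
  next
    case False
    then have "axis j 1 \<in> coord_lattice i n"
      unfolding coord_lattice_eq coord_lattice_gens_eq by (auto intro: group_closure.base)
    then show ?thesis
      using axis_int_mult_in_group_closure [of j 1 _ "int (p $ j) - int (q $ j)"]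
      unfolding coord_lattice_eq by simp
  qed
  have "(\<Sum>j\<in>J. axis j (of_nat (p $ j) - of_nat (q $ j))) \<in> coord_lattice i n" if "finite J" for J
    using that
    by (induction J) (use * in \<open>auto simp: coord_lattice_eq intro: group_closure_add\<close>)
  moreover have "(\<Sum>j\<in>UNIV. axis j (of_nat (p $ j) - of_nat (q $ j))) = rat_vec p - rat_vec q"
    by (simp add: vec_eq_iff axis_def rat_vec_def)
  ultimately show ?thesis by (metis finite)
qed

section \<open>First exponents outside a subgroup\<close>

locale dominating_order =
  fixes R :: "(rat ^ 'h :: finite) rel"
  assumes additive: "additive_order R"
    and dominating: "dominates R {x. \<forall>j. x $ j \<ge> 0}"
begin

section \<open>Minima and positivity for the order\<close>

lemma trans: "trans R" and antisym: "antisym R"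
  using additive
  by (auto simp: additive_order_def linear_order_on_def partial_order_on_def preorder_on_def)

lemma add_right: "(x, y) \<in> R \<Longrightarrow> (x + z, y + z) \<in> R"
  using additive by (auto simp: additive_order_def)

lemma minimum_eqI: "is_minimum R A x \<Longrightarrow> minimum R A = x"
  unfolding minimum_def is_minimum_def
  using antisym by (intro the_equality) (auto dest: antisymD)

text \<open>Natural exponents have the common denominator 1, so domination applies to every nonempty
  set of them.\<close>

lemma ex_minimum:
  fixes A :: "(nat ^ 'h) set"
  assumes "A \<noteq> {}"
  obtains p where "p \<in> A" "\<And>q. q \<in> A \<Longrightarrow> (rat_vec p, rat_vec q) \<in> R"
proof -
  have "bounded_denominators (rat_vec ` A)"
    unfolding bounded_denominators_def using assms
    by (auto intro!: exI [of _ "1 :: nat"] simp: rat_vec_def)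
  moreover have "rat_vec ` A \<subseteq> {x. \<forall>j. x $ j \<ge> 0}" by (auto simp: rat_vec_def)
  ultimately have "\<exists>m. is_minimum R (rat_vec ` A) m" using dominating by (auto simp: dominates_def)
  then show ?thesis using that by (auto simp: is_minimum_def)
qed

text \<open>Domination forces positivity: the multiples of \<open>p\<close> have a minimum
  \<open>k p\<close>, and cancelling \<open>k p\<close> from its comparison with
  \<open>(k + 1) p\<close> leaves 0 below \<open>p\<close>.\<close>

lemma zero_least: "(0, rat_vec p) \<in> R"
proof -
  let ?f = "\<lambda>k. \<chi> j. k * p $ j"
  obtain q where "q \<in> range ?f" and le: "\<And>r. r \<in> range ?f \<Longrightarrow> (rat_vec q, rat_vec r) \<in> R"
    by (rule ex_minimum [of "range ?f"]) auto
  then obtain k where "q = ?f k" by (elim rangeE)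
  then have "(rat_vec (?f k), rat_vec (?f (Suc k))) \<in> R"
    using le [OF rangeI [of ?f "Suc k"]] by (simp only:)
  moreover have "?f (Suc k) = ?f k + p" by (simp add: vec_eq_iff)
  ultimately have "(rat_vec (?f k), rat_vec (?f k) + rat_vec p) \<in> R" by (metis rat_vec_add)
  from add_right [OF this, of "- rat_vec (?f k)"] show ?thesis by simp
qed

lemma le_add: "(rat_vec p, rat_vec (p + q)) \<in> R" "(rat_vec p, rat_vec (q + p)) \<in> R"
proof -
  show "(rat_vec p, rat_vec (q + p)) \<in> R"
    using add_right [OF zero_least [of q], of "rat_vec p"] by (simp add: rat_vec_add)
  then show "(rat_vec p, rat_vec (p + q)) \<in> R"
    by (simp add: add.commute)
qed

lemma add_le_cancel: "(rat_vec (p + q), rat_vec p) \<in> R \<Longrightarrow> q = 0"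
  using antisymD [OF antisym le_add(1), of p q] by simp

text \<open>The coefficient at \<open>e\<close> may vanish, so one \<open>e\<close> can be tested
  against several series before it is known to occur in any of them.\<close>

definition late_outside :: "(rat ^ 'h) set \<Rightarrow> nat ^ 'h \<Rightarrow> ('k :: comm_ring_1, 'h) mfps \<Rightarrow> bool"
  where "late_outside K e f \<longleftrightarrow>
    (\<forall>p. mfps_nth f p \<noteq> 0 \<longrightarrow> rat_vec p \<in> K \<or> (rat_vec e, rat_vec p) \<in> R)"

text \<open>An exponent of the product is a sum of two: either both lie in the group, or one lies
  above \<open>e\<close> and adding a natural exponent keeps it there.\<close>

lemma late_outside_mult:
  assumes f: "late_outside (group_closure B) e f" and g: "late_outside (group_closure B) e g"
  shows "late_outside (group_closure B) e (f * g)"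
  unfolding late_outside_def
proof (intro allI impI)
  fix r assume "mfps_nth (f * g) r \<noteq> 0"
  then obtain p q where r: "p + q = r" and p: "mfps_nth f p \<noteq> 0" and q: "mfps_nth g q \<noteq> 0"
    unfolding mfps_nth_mult
    by (smt (verit) case_prodE mem_Collect_eq mult_zero_left mult_zero_right split_conv
      sum.not_neutral_contains_not_neutral)
  have "(rat_vec e, rat_vec r) \<in> R" if "(rat_vec e, rat_vec p) \<in> R \<or> (rat_vec e, rat_vec q) \<in> R"
    using that le_add trans r by (metis transD)
  then show "rat_vec r \<in> group_closure B \<or> (rat_vec e, rat_vec r) \<in> R"
    using f g p q r unfolding late_outside_def by (metis group_closure_add rat_vec_add)
qed

lemma late_outside_power:
  "late_outside (group_closure B) e f \<Longrightarrow> late_outside (group_closure B) e (f ^ k)"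
  by (induction k) (auto simp: late_outside_mult, simp add: late_outside_def mfps_nth_one)

text \<open>Removing from \<open>e\<close> a nonzero part \<open>p\<close> in the group leaves
  \<open>q\<close> outside the group and strictly below \<open>e\<close>, where \<open>f\<close> has
  no exponent.\<close>

lemma late_outside_eq_0:
  "late_outside (group_closure B) e f \<Longrightarrow> rat_vec (p + q) \<notin> group_closure B \<Longrightarrow> e = p + q \<Longrightarrow>
    p \<noteq> 0 \<Longrightarrow> rat_vec p \<in> group_closure B \<Longrightarrow> mfps_nth f q = 0"
  using add_le_cancel [of q p] unfolding late_outside_def
  by (metis add.commute group_closure_add_iff rat_vec_add)

text \<open>In a proper splitting \<open>p + q = e\<close>, either \<open>p\<close> is outside the
  group and strictly below \<open>e\<close>, or \<open>p\<close> is in the group and the same holds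
  for \<open>q\<close>. Such terms vanish, which leaves the product rule.\<close>

lemma mfps_nth_mult_late:
  assumes f: "late_outside (group_closure B) e f" and g: "late_outside (group_closure B) e g"
    and e: "rat_vec e \<notin> group_closure B"
  shows "mfps_nth (f * g) e = mfps_nth f e * mfps_nth g 0 + mfps_nth f 0 * mfps_nth g e"
proof -
  have "e \<noteq> 0" using e by auto
  have zero: "mfps_nth f p * mfps_nth g q = 0" if "p + q = e" "p \<noteq> 0" "q \<noteq> 0" for p q
  proof (cases "rat_vec p \<in> group_closure B")
    case True
    then show ?thesis using late_outside_eq_0 [OF g] that e by auto
  next
    case False
    then have "mfps_nth f p = 0"
      using f that add_le_cancel [of p q] unfolding late_outside_def by metis
    then show ?thesis by simp
  qed
  show ?thesis
    using sum_vec_add_eq_ends [of e "\<lambda>p q. mfps_nth f p * mfps_nth g q", OF \<open>e \<noteq> 0\<close> zero]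
    by (simp add: mfps_nth_mult add.commute)
qed

lemma mfps_nth_power_late:
  assumes f: "late_outside (group_closure B) e f" and e: "rat_vec e \<notin> group_closure B"
  shows "mfps_nth (f ^ k) e = of_nat k * mfps_nth f 0 ^ (k - 1) * mfps_nth f e"
proof (induction k)
  case 0
  from e have "e \<noteq> 0" by auto
  then show ?case by (simp add: mfps_nth_one)
next
  case (Suc k)
  have "mfps_nth (f ^ Suc k) e = mfps_nth f e * mfps_nth f 0 ^ k + mfps_nth f 0 * mfps_nth (f ^ k) e"
    using mfps_nth_mult_late [OF f late_outside_power [OF f] e] by (simp add: mfps_nth_power_0)
  also have "\<dots> = of_nat (Suc k) * mfps_nth f 0 ^ k * mfps_nth f e"
    unfolding Suc
    \<comment> \<open>The split handles the natural subtraction \<open>k - 1\<close>: at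
      \<open>k = 0\<close> the factor \<open>of_nat k\<close> kills the term.\<close>
    by (cases k)
      (simp_all add: distrib_left distrib_right mult.assoc mult.left_commute mult.commute)
  finally show ?case by simp
qed

text \<open>Compares coefficients at \<open>axis i 1 + e\<close> in the identity that the
  composition is \<open>mfps_X i\<close>. The splitting \<open>p = 0\<close> contributes
  \<open>\<psi>\<close> itself, the splitting \<open>p = e\<close> the constant term of
  \<open>\<psi> ^ Suc (e $ i)\<close>.\<close>

lemma dual_coeff:
  fixes \<phi> \<psi> :: "('k :: comm_ring_1, 'h) mfps"
  assumes dual: "dual_wrt i \<phi> \<psi>"
    and \<phi>: "late_outside (group_closure B) e \<phi>" and \<psi>: "late_outside (group_closure B) e \<psi>"
    and e: "rat_vec e \<notin> group_closure B"
  shows "mfps_nth \<phi> 0 * mfps_nth \<psi> e = - mfps_nth \<phi> e * mfps_nth \<psi> 0 ^ Suc (e $ i)"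
proof -
  let ?t = "\<lambda>p q. mfps_nth \<phi> p * mfps_nth (\<psi> ^ Suc (p $ i)) q"
  have "e \<noteq> 0" using e by auto
  have zero: "?t p q = 0" if "p + q = e" "p \<noteq> 0" "q \<noteq> 0" for p q
  proof (cases "rat_vec p \<in> group_closure B")
    case True
    then have "mfps_nth (\<psi> ^ Suc (p $ i)) q = 0"
      using late_outside_eq_0 [OF late_outside_power [OF \<psi>]] that e by blast
    then show ?thesis by simp
  next
    case False
    then have "mfps_nth \<phi> p = 0"
      using \<phi> that add_le_cancel [of p q] unfolding late_outside_def by metis
    then show ?thesis by simp
  qed
  have "0 = mfps_nth (mfps_X i :: ('k, 'h) mfps) (axis i 1 + e)"
    using \<open>e \<noteq> 0\<close> by (simp add: mfps_X_def)
  also have "\<dots> = (\<Sum>(p, q)\<in>{(p, q). p + q = e}. ?t p q)"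
    using dual mfps_nth_compose_mult_map [of i \<phi> \<psi> e] by (simp add: dual_wrt_def)
  also have "\<dots> = mfps_nth \<phi> 0 * mfps_nth \<psi> e + mfps_nth \<phi> e * mfps_nth \<psi> 0 ^ Suc (e $ i)"
    using sum_vec_add_eq_ends [of e ?t, OF \<open>e \<noteq> 0\<close> zero]
    by (simp add: mfps_nth_mult_0 mfps_nth_power_0)
  finally show ?thesis by (simp add: eq_neg_iff_add_eq_0)
qed

end

text \<open>This is the coefficient at \<open>axis i 1\<close> of the same composition
  identity.\<close>

lemma dual_wrt_nth_0:
  fixes \<phi> \<psi> :: "('k :: comm_ring_1, 'h :: finite) mfps"
  assumes "dual_wrt i \<phi> \<psi>"
  shows "mfps_nth \<phi> 0 * mfps_nth \<psi> 0 = 1"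
proof -
  have "mfps_nth (mfps_X i :: ('k, 'h) mfps) (axis i 1 + 0) =
      (\<Sum>(p, q)\<in>{(p, q). p + q = 0}. mfps_nth \<phi> p * mfps_nth (\<psi> ^ Suc (p $ i)) q)"
    using assms mfps_nth_compose_mult_map [of i \<phi> \<psi> 0] by (simp add: dual_wrt_def)
  moreover have "{(p, q). p + q = (0 :: nat ^ 'h)} = {(0, 0)}"
    by (auto simp: vec_nat_add_eq_0_iff)
  ultimately show ?thesis by (simp add: mfps_X_def)
qed

section \<open>First exponents of powers and of dual series\<close>

context dominating_order
begin

definition first_outside :: "(rat ^ 'h) set \<Rightarrow> nat ^ 'h \<Rightarrow> ('k :: comm_ring_1, 'h) mfps \<Rightarrow> bool"
  where "first_outside K e f \<longleftrightarrow> rat_vec e \<notin> K \<and> mfps_nth f e \<noteq> 0 \<and> late_outside K e f"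

text \<open>By the power formula the coefficient at \<open>e\<close> is multiplied by
  \<open>m\<close> times a power of the constant term, which is nonzero in characteristic
  zero.\<close>

lemma first_outside_power:
  fixes f :: "('k :: field_char_0, 'h) mfps"
  assumes "first_outside (group_closure B) e f" and "mfps_nth f 0 \<noteq> 0" and "m > 0"
  shows "first_outside (group_closure B) e (f ^ m)"
  using assms late_outside_power [of B e f m] mfps_nth_power_late [of B e f m]
  by (simp add: first_outside_def)

lemma first_outside_dual:
  fixes \<phi> \<psi> :: "('k :: field, 'h) mfps"
  assumes dual: "dual_wrt i \<phi> \<psi>"
  shows "(\<forall>p. mfps_nth \<phi> p \<noteq> 0 \<or> mfps_nth \<psi> p \<noteq> 0 \<longrightarrow> rat_vec p \<in> group_closure B) \<or>
    (\<exists>e. first_outside (group_closure B) e \<phi> \<and> first_outside (group_closure B) e \<psi> \<and>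
      mfps_nth \<phi> 0 * mfps_nth \<psi> e = - mfps_nth \<phi> e * mfps_nth \<psi> 0 ^ Suc (e $ i))"
    (is "?in \<or> ?ex")
proof (cases ?in)
  case False
  \<comment> \<open>Minimizing over both supports at once gives an \<open>e\<close> that is late for
    both series; the coefficient identity then shows that it occurs in both.\<close>
  define A where "A = {p. (mfps_nth \<phi> p \<noteq> 0 \<or> mfps_nth \<psi> p \<noteq> 0) \<and> rat_vec p \<notin> group_closure B}"
  from False have "A \<noteq> {}" by (auto simp: A_def)
  then obtain e where "e \<in> A" and le: "\<And>p. p \<in> A \<Longrightarrow> (rat_vec e, rat_vec p) \<in> R"
    by (rule ex_minimum) blast
  then have e: "rat_vec e \<notin> group_closure B" "mfps_nth \<phi> e \<noteq> 0 \<or> mfps_nth \<psi> e \<noteq> 0"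
    by (auto simp: A_def)
  have late: "late_outside (group_closure B) e \<phi>" "late_outside (group_closure B) e \<psi>"
    using le by (auto simp: late_outside_def A_def)
  have eq: "mfps_nth \<phi> 0 * mfps_nth \<psi> e = - mfps_nth \<phi> e * mfps_nth \<psi> 0 ^ Suc (e $ i)"
    using dual_coeff [OF dual late e(1)] .
  have "mfps_nth \<phi> 0 \<noteq> 0" "mfps_nth \<psi> 0 \<noteq> 0" using dual by (auto simp: dual_wrt_def)
  with eq e(2) have "mfps_nth \<phi> e \<noteq> 0" "mfps_nth \<psi> e \<noteq> 0" by auto
  with e(1) late eq show ?thesis by (auto simp: first_outside_def)
qed simp

text \<open>With no exponent outside the group, the series is late for any outside \<open>p\<close>,
  so the power formula at \<open>p\<close> itself gives a multiple of a zero coefficient.\<close>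

lemma power_support_in_group_closure:
  fixes f :: "('k :: comm_ring_1, 'h) mfps"
  assumes "\<And>p. mfps_nth f p \<noteq> 0 \<Longrightarrow> rat_vec p \<in> group_closure B"
  shows "mfps_nth (f ^ k) p \<noteq> 0 \<Longrightarrow> rat_vec p \<in> group_closure B"
proof (rule ccontr)
  assume *: "mfps_nth (f ^ k) p \<noteq> 0" "rat_vec p \<notin> group_closure B"
  have "late_outside (group_closure B) p f" using assms by (auto simp: late_outside_def)
  from mfps_nth_power_late [OF this *(2), of k] * assms [of p] show False by (metis mult_zero_right)
qed

section \<open>Minima of the shifted supports\<close>

lemma mfps_support_X_mult_power:
  "mfps_support ((mfps_X i * f) ^ k) =
    (\<lambda>s. rat_vec (axis i k) + rat_vec s) ` {s. mfps_nth (f ^ k) s \<noteq> 0}"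
proof -
  have "{r. mfps_nth ((mfps_X i * f) ^ k) r \<noteq> 0} = (\<lambda>s. axis i k + s) ` {s. mfps_nth (f ^ k) s \<noteq> 0}"
    by (auto simp: mfps_nth_X_mult_power(1))
  then show ?thesis by (simp add: mfps_support_def image_image rat_vec_add)
qed

text \<open>Shifting by \<open>axis i k\<close>, an element of the group, affects neither membership
  in the group nor comparisons, so the first exponent is merely shifted.\<close>

lemma minimum_outside:
  assumes "rat_vec (axis i k) \<in> group_closure B" and "first_outside (group_closure B) e (f ^ k)"
  shows "minimum R (mfps_support ((mfps_X i * f) ^ k) - group_closure B) = rat_vec (axis i k + e)"
    and "\<not> mfps_support ((mfps_X i * f) ^ k) \<subseteq> group_closure B"
proof -
  have e: "rat_vec (axis i k) + rat_vec e \<in> mfps_support ((mfps_X i * f) ^ k) - group_closure B"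
    using assms
    by (auto simp: first_outside_def mfps_support_X_mult_power group_closure_add_iff)
  then show "\<not> mfps_support ((mfps_X i * f) ^ k) \<subseteq> group_closure B" by blast
  have "(rat_vec (axis i k) + rat_vec e, x) \<in> R"
    if "x \<in> mfps_support ((mfps_X i * f) ^ k) - group_closure B" for x
  proof -
    from that obtain s where s: "x = rat_vec (axis i k) + rat_vec s" "mfps_nth (f ^ k) s \<noteq> 0"
      "rat_vec s \<notin> group_closure B"
      using assms(1) by (auto simp: mfps_support_X_mult_power group_closure_add_iff)
    then have "(rat_vec e, rat_vec s) \<in> R"
      using assms(2) by (auto simp: first_outside_def late_outside_def)
    from add_right [OF this, of "rat_vec (axis i k)"] s(1) show ?thesis by (simp add: add.commute)
  qed
  with e show "minimum R (mfps_support ((mfps_X i * f) ^ k) - group_closure B) = rat_vec (axis i k + e)"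
    by (intro minimum_eqI) (auto simp: is_minimum_def rat_vec_add)
qed

lemma minimum_support:
  assumes "mfps_nth f 0 \<noteq> (0 :: 'k :: idom)"
  shows "minimum R (mfps_support ((mfps_X i * f) ^ k)) = rat_vec (axis i k)"
proof (rule minimum_eqI)
  have "mfps_nth (f ^ k) 0 \<noteq> 0" using assms by (simp add: mfps_nth_power_0)
  moreover have "(rat_vec (axis i k), rat_vec (axis i k) + rat_vec s) \<in> R" for s
    using le_add(1) [of "axis i k" s] by (simp add: rat_vec_add)
  ultimately show "is_minimum R (mfps_support ((mfps_X i * f) ^ k)) (rat_vec (axis i k))"
    by (auto simp: is_minimum_def mfps_support_X_mult_power image_iff intro!: exI [of _ 0])
qed

end

section \<open>Essential exponents of dual series\<close>

locale dual_series = dominating_order R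
  for R :: "(rat ^ 'h :: finite) rel" +
  fixes i :: 'h and \<phi> \<psi> :: "('k :: field_char_0, 'h) mfps" and m n :: nat
  assumes dual: "dual_wrt i \<phi> \<psi>"
    and m: "m > 0" and n: "n > 0"
begin

abbreviation "\<eta> \<equiv> (mfps_X i * \<phi>) ^ m"
abbreviation "\<xi> \<equiv> (mfps_X i * \<psi>) ^ n"

section \<open>The two recursions in terms of generators\<close>

definition earlier :: "(rat ^ 'h) set \<Rightarrow> (rat ^ 'h) set \<Rightarrow> nat \<Rightarrow> (rat ^ 'h) set"
  where "earlier E M l = {e. \<exists>j\<in>{..<l}. ess E M R j = Some e}"

lemma earlier_Suc: "earlier E M (Suc l) = earlier E M l \<union> {e. ess E M R l = Some e}"
  by (auto simp: earlier_def less_Suc_eq)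

lemma ess_eq:
  "l > 0 \<Longrightarrow> ess E (coord_lattice i k) R l =
    (let H = group_closure (coord_lattice_gens i k \<union> earlier E (coord_lattice i k) l)
     in if E \<subseteq> H then None else Some (minimum R (E - H)))"
  by (subst ess.simps) (simp add: coord_lattice_eq group_closure_plus earlier_def)

abbreviation "ess_\<eta> \<equiv> ess (mfps_support \<eta>) (coord_lattice i n) R"
abbreviation "ess_\<xi> \<equiv> ess (mfps_support \<xi>) (coord_lattice i m) R"
definition "gens_\<eta> l = coord_lattice_gens i n \<union> earlier (mfps_support \<eta>) (coord_lattice i n) l"
definition "gens_\<xi> l = coord_lattice_gens i m \<union> earlier (mfps_support \<xi>) (coord_lattice i m) l"

lemma ess_0: "ess_\<eta> 0 = Some (rat_vec (axis i m))" "ess_\<xi> 0 = Some (rat_vec (axis i n))"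
  using dual by (subst ess.simps, simp add: minimum_support dual_wrt_def)+

lemma gens_Suc:
  "gens_\<eta> (Suc l) = {e. ess_\<eta> l = Some e} \<union> gens_\<eta> l"
  "gens_\<xi> (Suc l) = {e. ess_\<xi> l = Some e} \<union> gens_\<xi> l"
  by (auto simp: gens_\<eta>_def gens_\<xi>_def earlier_Suc)

text \<open>\<open>axis i m\<close> enters as the essential exponent of index 0, hence from
  \<open>l = 1\<close> on; \<open>axis i n\<close> is a lattice generator.\<close>

lemma axis_in_gens:
  "l > 0 \<Longrightarrow> rat_vec (axis i m) \<in> gens_\<eta> l" "rat_vec (axis i n) \<in> gens_\<eta> l"
  using ess_0 by (auto simp: gens_\<eta>_def earlier_def coord_lattice_gens_eq)

text \<open>\<open>e\<close> is the exponent before the shift, common to both series. Nonmembership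
  is recorded for the finiteness argument, the coefficient relation for the final formula.\<close>

definition paired :: "nat \<Rightarrow> nat ^ 'h \<Rightarrow> bool"
  where "paired l e \<longleftrightarrow>
    ess_\<eta> l = Some (rat_vec (axis i m + e)) \<and> ess_\<xi> l = Some (rat_vec (axis i n + e)) \<and>
    rat_vec (axis i m + e) \<notin> group_closure (gens_\<eta> l) \<and>
    mfps_nth \<xi> (axis i n + e) = - (of_nat n / of_nat m) *
      mfps_nth \<phi> 0 powi (- int n - int ((axis i m + e) $ i)) * mfps_nth \<eta> (axis i m + e)"

text \<open>With equal groups, both recursions seek the first exponent of \<open>\<phi> ^ m\<close>
  and of \<open>\<psi> ^ n\<close> outside one group; by duality both are absent or both are the
  same \<open>e\<close>.\<close>

lemma ess_step:
  assumes "l > 0" and eq: "group_closure (gens_\<eta> l) = group_closure (gens_\<xi> l)"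
  shows "ess_\<eta> l = None \<and> ess_\<xi> l = None \<or> (\<exists>e. paired l e)"
proof -
  let ?B = "gens_\<eta> l"
  have axes: "rat_vec (axis i m) \<in> group_closure ?B" "rat_vec (axis i n) \<in> group_closure ?B"
    using axis_in_gens \<open>l > 0\<close> by (auto intro: group_closure.base)
  have ess_\<eta>: "ess_\<eta> l = (if mfps_support \<eta> \<subseteq> group_closure ?B then None
      else Some (minimum R (mfps_support \<eta> - group_closure ?B)))"
    by (simp add: ess_eq [OF \<open>l > 0\<close>] gens_\<eta>_def)
  have ess_\<xi>: "ess_\<xi> l = (if mfps_support \<xi> \<subseteq> group_closure ?B then None
      else Some (minimum R (mfps_support \<xi> - group_closure ?B)))"
    by (simp add: ess_eq [OF \<open>l > 0\<close>] eq) (simp add: gens_\<xi>_def)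
  from first_outside_dual [OF dual, of ?B] show ?thesis
  proof (elim disjE exE conjE)
    assume "\<forall>p. mfps_nth \<phi> p \<noteq> 0 \<or> mfps_nth \<psi> p \<noteq> 0 \<longrightarrow> rat_vec p \<in> group_closure ?B"
    then have "mfps_nth (\<phi> ^ m) p \<noteq> 0 \<Longrightarrow> rat_vec p \<in> group_closure ?B"
      "mfps_nth (\<psi> ^ n) p \<noteq> 0 \<Longrightarrow> rat_vec p \<in> group_closure ?B" for p
      by (blast intro: power_support_in_group_closure)+
    then have "mfps_support \<eta> \<subseteq> group_closure ?B" "mfps_support \<xi> \<subseteq> group_closure ?B"
      by (auto simp: mfps_support_X_mult_power group_closure_add_iff axes)
    then show ?thesis by (simp add: ess_\<eta> ess_\<xi>)
  next
    fix e
    assume e: "first_outside (group_closure ?B) e \<phi>" "first_outside (group_closure ?B) e \<psi>"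
      and coeff: "mfps_nth \<phi> 0 * mfps_nth \<psi> e = - mfps_nth \<phi> e * mfps_nth \<psi> 0 ^ Suc (e $ i)"
    define a where "a = mfps_nth \<phi> 0"
    have \<psi>0: "mfps_nth \<psi> 0 = inverse a"
      using inverse_unique [OF dual_wrt_nth_0 [OF dual]] by (simp add: a_def)
    have "a \<noteq> 0" using dual by (simp add: a_def dual_wrt_def)
    with \<psi>0 have "first_outside (group_closure ?B) e (\<phi> ^ m)"
      "first_outside (group_closure ?B) e (\<psi> ^ n)"
      using e m n by (auto intro!: first_outside_power simp: a_def)
    note min = minimum_outside [OF axes(1) this(1)] minimum_outside [OF axes(2) this(2)]
    have nth: "mfps_nth (\<phi> ^ m) e = of_nat m * a ^ (m - 1) * mfps_nth \<phi> e"
      "mfps_nth (\<psi> ^ n) e = of_nat n * inverse a ^ (n - 1) * mfps_nth \<psi> e"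
      unfolding \<psi>0 [symmetric] unfolding a_def
      using e by (auto simp: first_outside_def mfps_nth_power_late)
    \<comment> \<open>Dividing the dual identity by \<open>a\<close> raises the exponent of
      \<open>inverse a\<close> from \<open>e $ i + 1\<close> to \<open>e $ i + 2\<close>.\<close>
    have \<psi>e: "mfps_nth \<psi> e = - mfps_nth \<phi> e * inverse a ^ (e $ i + 2)"
      using coeff \<open>a \<noteq> 0\<close> by (simp add: \<psi>0 field_simps flip: a_def)
    have pow: "a powi (- int n - int (m + e $ i)) = inverse a ^ (n + m + e $ i)"
    proof -
      have "- int n - int (m + e $ i) = - int (n + m + e $ i)" by simp
      then show ?thesis by (simp only: power_int_minus power_int_of_nat power_inverse)
    qed
    \<comment> \<open>Both sides equal \<open>inverse a ^ (n + 1 + e $ i)\<close>; positivity of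
      \<open>m\<close> and \<open>n\<close> makes the natural subtractions exact.\<close>
    have *: "inverse a ^ (n + m + e $ i) * a ^ (m - 1) = inverse a ^ (n - 1) * inverse a ^ (e $ i + 2)"
      using m n \<open>a \<noteq> 0\<close> by (cases m; cases n) (simp_all add: field_simps power_add)
    have "- (of_nat n / of_nat m) * a powi (- int n - int (m + e $ i)) * mfps_nth (\<phi> ^ m) e =
        - of_nat n * mfps_nth \<phi> e * (inverse a ^ (n + m + e $ i) * a ^ (m - 1))"
      unfolding nth pow using m by simp
    also have "\<dots> = mfps_nth (\<psi> ^ n) e"
      unfolding * nth \<psi>e by simp
    finally have "mfps_nth \<xi> (axis i n + e) = - (of_nat n / of_nat m) *
        mfps_nth \<phi> 0 powi (- int n - int ((axis i m + e) $ i)) * mfps_nth \<eta> (axis i m + e)"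
      by (simp add: mfps_nth_X_mult_power(2) a_def)
    moreover have "rat_vec (axis i m + e) \<notin> group_closure ?B"
      using e(1) by (simp add: rat_vec_add group_closure_add_iff axes first_outside_def)
    ultimately have "paired l e"
      unfolding paired_def ess_\<eta> ess_\<xi> using min by simp
    then show ?thesis by blast
  qed
qed

text \<open>The induction starts at \<open>l = 1\<close>, where the minimum of index 0 of each
  series supplies the generator in direction \<open>i\<close> of the other lattice.\<close>

lemma group_closure_gens_eq: "l > 0 \<Longrightarrow> group_closure (gens_\<eta> l) = group_closure (gens_\<xi> l)"
proof (induction l rule: nat_induct_non_zero)
  case 1
  show ?case
    by (simp add: gens_\<eta>_def gens_\<xi>_def earlier_def ess_0 coord_lattice_gens_eq insert_commute)
next
  case (Suc l)
  from ess_step [OF Suc] show ?case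
  proof (elim disjE exE)
    assume "ess_\<eta> l = None \<and> ess_\<xi> l = None"
    with Suc show ?case by (simp add: gens_Suc)
  next
    fix e assume "paired l e"
    then have ess: "ess_\<eta> l = Some (rat_vec (axis i m + e))" "ess_\<xi> l = Some (rat_vec (axis i n + e))"
      by (simp_all add: paired_def)
    \<comment> \<open>The paired exponents share \<open>e\<close>, so this is also their difference,
      and either one may replace the other as a generator.\<close>
    have "rat_vec (axis i m) - rat_vec (axis i n) \<in> group_closure (gens_\<xi> l)"
      unfolding Suc.IH [symmetric] using axis_in_gens Suc.hyps
      by (intro group_closure.diff) (auto intro: group_closure.base)
    then have "rat_vec (axis i m + e) - rat_vec (axis i n + e) \<in> group_closure (gens_\<xi> l)"
      by (simp add: rat_vec_add)
    from group_closure_insert_cong [OF Suc.IH this] show ?case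
      by (simp add: gens_Suc ess)
  qed
qed

section \<open>Termination of both sequences\<close>

lemma ess_cases: "l > 0 \<Longrightarrow> ess_\<eta> l = None \<and> ess_\<xi> l = None \<or> (\<exists>e. paired l e)"
  using ess_step group_closure_gens_eq by blast

lemma ess_None_mono: "ess_\<eta> l = None \<Longrightarrow> l \<le> l' \<Longrightarrow> ess_\<eta> l' = None"
proof -
  assume l: "ess_\<eta> l = None" "l \<le> l'"
  then have "l > 0" using ess_0 by (cases l) auto
  have "gens_\<eta> l \<subseteq> gens_\<eta> l'" using l(2) by (auto simp: gens_\<eta>_def earlier_def)
  from group_closure_mono [OF this] l \<open>l > 0\<close> show ?thesis
    by (auto simp: ess_eq Let_def split: if_splits simp flip: gens_\<eta>_def)
qed

text \<open>All essential exponents have distinct first coordinates modulo \<open>n\<close>.\<close>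
lemma ex_ess_None: "\<exists>l. ess_\<eta> l = None"
proof (rule ccontr)
  assume none: "\<nexists>l. ess_\<eta> l = None"
  then have "\<forall>l. \<exists>x. ess_\<eta> l = Some (rat_vec x) \<and> (l > 0 \<longrightarrow> rat_vec x \<notin> group_closure (gens_\<eta> l))"
    using ess_cases ess_0 unfolding paired_def by (metis gr0I)
  then obtain x where x: "\<And>l. ess_\<eta> l = Some (rat_vec (x l))"
    "\<And>l. l > 0 \<Longrightarrow> rat_vec (x l) \<notin> group_closure (gens_\<eta> l)"
    by metis
  \<comment> \<open>Pigeonhole: infinitely many indices, but only \<open>n\<close> residues.\<close>
  have "\<not> inj (\<lambda>l. x l $ i mod n)"
  proof
    assume "inj (\<lambda>l. x l $ i mod n)"
    moreover have "range (\<lambda>l. x l $ i mod n) \<subseteq> {..<n}" using n by auto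
    ultimately show False using finite_subset infinite_UNIV_nat finite_imageD by blast
  qed
  then obtain j k where "j < k" and "x k $ i mod n = x j $ i mod n"
    unfolding inj_def by (metis linorder_neqE_nat)
  then have "rat_vec (x k) - rat_vec (x j) \<in> coord_lattice i n"
    by (intro rat_vec_diff_in_coord_lattice)
  \<comment> \<open>The group of the larger index \<open>k\<close> contains the lattice and the
    earlier exponent \<open>x j\<close>, hence also \<open>x k\<close>, which was chosen outside
    it.\<close>
  then have "rat_vec (x k) - rat_vec (x j) \<in> group_closure (gens_\<eta> k)"
    unfolding coord_lattice_eq gens_\<eta>_def using group_closure_mono [OF Un_upper1] by blast
  moreover have "rat_vec (x j) \<in> group_closure (gens_\<eta> k)"
    using x(1) \<open>j < k\<close> by (intro group_closure.base) (auto simp: gens_\<eta>_def earlier_def)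
  ultimately have "rat_vec (x k) - rat_vec (x j) + rat_vec (x j) \<in> group_closure (gens_\<eta> k)"
    by (rule group_closure_add)
  with x(2) [of k] \<open>j < k\<close> show False by simp
qed

lemma ex_paired_sequence:
  obtains d e where "\<And>k. k > d \<Longrightarrow> ess_\<eta> k = None \<and> ess_\<xi> k = None"
    and "\<And>k. k \<in> {1..d} \<Longrightarrow> paired k (e k)"
proof -
  \<comment> \<open>The first undefined index. Index 0 is defined, so \<open>d = l - 1\<close>
    counts the exponents after the initial one. A pair leaves neither side undefined, so both
    sequences stop together.\<close>
  define l where "l = (LEAST l. ess_\<eta> l = None)"
  have l: "ess_\<eta> l = None" unfolding l_def using ex_ess_None by (rule LeastI_ex)
  then have "l > 0" using ess_0 by (cases l) auto
  have "ess_\<eta> k = None \<and> ess_\<xi> k = None" if "k > l - 1" for k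
    using ess_cases [of k] ess_None_mono [OF l, of k] that by (auto simp: paired_def)
  moreover have "\<exists>e. paired k e" if "k \<in> {1..l - 1}" for k
  proof -
    have "k < l" using that by auto
    then have "ess_\<eta> k \<noteq> None" unfolding l_def by (rule not_less_Least)
    then show ?thesis using ess_cases [of k] that by auto
  qed
  then obtain e where "\<And>k. k \<in> {1..l - 1} \<Longrightarrow> paired k (e k)" by metis
  ultimately show ?thesis using that by blast
qed

end

theorem theorem5p20:
  fixes i :: "'h :: finite"
    and \<eta>' \<xi>' \<eta> \<xi> :: "('k :: {alg_closed_field, field_char_0}, 'h) mfps"
    and m n :: nat
    and a :: 'k
    and R :: "(rat ^ 'h) rel"
  assumes dual: "dual_wrt i \<eta>' \<xi>'"
    and "m > 0" and "n > 0"
    and a: "a = mfps_nth \<eta>' 0"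
    and \<eta>: "\<eta> = (mfps_X i * \<eta>') ^ m"
    and \<xi>: "\<xi> = (mfps_X i * \<xi>') ^ n"
    and order: "additive_order R"
    and dom: "dominates R {x. \<forall>j. x $ j \<ge> 0}"
  shows "\<exists>(d :: nat) (d' :: nat) (\<epsilon> :: nat \<Rightarrow> nat ^ 'h) (\<epsilon>' :: nat \<Rightarrow> nat ^ 'h).
     ess (mfps_support \<eta>) (coord_lattice i n) R =
       (\<lambda>k. if k \<le> d then Some (rat_vec (\<epsilon> k)) else None) \<and>
     ess (mfps_support \<xi>) (coord_lattice i m) R =
       (\<lambda>k. if k \<le> d' then Some (rat_vec (\<epsilon>' k)) else None) \<and>
     \<epsilon> 0 = axis i m \<and> \<epsilon>' 0 = axis i n \<and>
     d' = d \<and>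
     (\<forall>k\<in>{1..d}. \<epsilon>' k + axis i m = \<epsilon> k + axis i n) \<and>
     mfps_nth \<xi> (axis i n) = a powi (- int n) \<and>
     (\<forall>k\<in>{1..d}. mfps_nth \<xi> (\<epsilon>' k) =
        - (of_nat n / of_nat m) * a powi (- int n - int (\<epsilon> k $ i)) * mfps_nth \<eta> (\<epsilon> k))"
proof -
  interpret dual_series R i \<eta>' \<xi>' m n
    using assms by unfold_locales
  obtain d e where None: "\<And>k. k > d \<Longrightarrow> ess_\<eta> k = None \<and> ess_\<xi> k = None"
    and e: "\<And>k. k \<in> {1..d} \<Longrightarrow> paired k (e k)"
    using ex_paired_sequence by blast
  define \<epsilon> where "\<epsilon> k = (if k = 0 then axis i m else axis i m + e k)" for k
  define \<epsilon>' where "\<epsilon>' k = (if k = 0 then axis i n else axis i n + e k)" for k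
  have ess: "ess_\<eta> k = (if k \<le> d then Some (rat_vec (\<epsilon> k)) else None)"
    "ess_\<xi> k = (if k \<le> d then Some (rat_vec (\<epsilon>' k)) else None)" for k
    using ess_0 None [of k] e [of k] by (auto simp: \<epsilon>_def \<epsilon>'_def paired_def)
  have "mfps_nth \<xi>' 0 = inverse a"
    using inverse_unique [OF dual_wrt_nth_0 [OF dual]] by (simp add: a)
  \<comment> \<open>At \<open>s = 0\<close> the shift formula gives the constant term of
    \<open>\<xi>' ^ n\<close>.\<close>
  then have "mfps_nth \<xi> (axis i n) = a powi (- int n)"
    using mfps_nth_X_mult_power(2) [of i \<xi>' n 0]
    by (simp add: \<xi> mfps_nth_power_0 power_int_minus power_inverse)
  moreover have "\<forall>k\<in>{1..d}. \<epsilon>' k + axis i m = \<epsilon> k + axis i n"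
    by (simp add: \<epsilon>_def \<epsilon>'_def ac_simps)
  moreover have "\<forall>k\<in>{1..d}. mfps_nth \<xi> (\<epsilon>' k) =
      - (of_nat n / of_nat m) * a powi (- int n - int (\<epsilon> k $ i)) * mfps_nth \<eta> (\<epsilon> k)"
    using e by (auto simp: paired_def \<epsilon>_def \<epsilon>'_def a \<eta> \<xi>)
  ultimately show ?thesis
    using ess unfolding \<eta> \<xi>
    by (intro exI [of _ d] exI [of _ \<epsilon>] exI [of _ \<epsilon>']) (simp add: fun_eq_iff \<epsilon>_def \<epsilon>'_def)
qed

end
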